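(* Let $\alpha\in(0,1)$ and $\beta\in(1/2,1)$, and let the temporal and spatial discretizations be uniform with step sizes $\tau$ and $h$, respectively. Then the condition number of the coefficient matrix $C^n_{h\tau}$ (defined in the context) satisfies $$\kappa(C^n_{h\tau})=1+\mathcal{O}(\tau^\alpha h^{-2\beta}).$$
   Context: Let $\Omega=(a,b)$ be divided uniformly into $M$ cells of size $h=(b-a)/M$, and let $(0,T)$ be divided uniformly with time step $\tau$. The coefficient matrix of the fully discrete finite element scheme is the $(M-1)\times(M-1)$ matrix $$C^n_{h\tau}=M_h+\frac{\Gamma(3-\alpha)}{2}\,\tau^\alpha A_h^\beta .$$ Here $M_h$ is the mass matrix, i.e. the symmetric tridiagonal matrix with diagonal entries $\frac{4h}{6}$ and sub- and superdiagonal entries $\frac{h}{6}$, and $A_h^\beta=(a^h_{i,j})$ is the stiffness matrix with entries $$a^h_{i,i}=\frac{h^{1-2\beta}(2^{4-2\beta}-8)}{2\cos(\beta\pi)\Gamma(4-2\beta)},\quad i=1,\dots,M-1,$$ $$a^h_{j,j+1}=a^h_{j+1,j}=\frac{h^{1-2\beta}(3^{3-2\beta}-2^{5-2\beta}+7)}{2\cos(\beta\pi)\Gamma(4-2\beta)},\quad j=1,\dots,M-2,$$ and, for $l\ge 2$ and $k=1,\dots,M-l-1$, $$a^h_{k,k+l}=a^h_{k+l,k}=\frac{h^{1-2\beta}}{2\cos(\beta\pi)\Gamma(4-2\beta)}\Big[(l+2)^{3-2\beta}-4(l+1)^{3-2\beta}+6l^{3-2\beta}-4(l-1)^{3-2\beta}+(l-2)^{3-2\beta}\Big].$$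 $\kappa$ denotes the spectral condition number $\lambda_{\max}/\lambda_{\min}$ of a symmetric positive definite matrix. Constants implied by $\mathcal{O}$ are independent of the time and space step sizes $\tau$ and $h$.
   Formalization: As stated it is false (M=3, τ→0: κ→5/3, τ^α h^{-2β}→0); proved instead: κ=1+O(τ^α h^{-2β}) where τ^α h^{-2β}≥c, for every c>0 with constant depending on c, and 1≤κ≤K(1+τ^α h^{-2β}) for all τ=T/N, h=(b-a)/M, M≥2. *)

theory Defs
  imports
    "HOL-Analysis.Gamma_Function"
    "Jordan_Normal_Form.Spectral_Radius"
begin

(* Row and column indices are 0-based: the (i, j) entry here is the (i + 1, j + 1) entry in the
   usual 1-based numbering. M is the number of cells, so there are M - 1 interior nodes. *)

definition mass_matrix :: "real \<Rightarrow> nat \<Rightarrow> real mat" where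
  "mass_matrix h M = mat (M - 1) (M - 1) (\<lambda>(i, j).
     if i = j then 4 * h / 6
     else if i = Suc j \<or> j = Suc i then h / 6
     else 0)"

(* The entries of the stiffness matrix depend only on the distance l of the two indices.
   In the last case l >= 2, and for l = 2 the final summand is 0 powr (3 - 2 * beta) = 0. *)

definition stiffness_entry :: "real \<Rightarrow> real \<Rightarrow> nat \<Rightarrow> real" where
  "stiffness_entry \<beta> h l =
     h powr (1 - 2 * \<beta>) / (2 * cos (\<beta> * pi) * Gamma (4 - 2 * \<beta>)) *
     (if l = 0 then 2 powr (4 - 2 * \<beta>) - 8
      else if l = 1 then 3 powr (3 - 2 * \<beta>) - 2 powr (5 - 2 * \<beta>) + 7
      else (real l + 2) powr (3 - 2 * \<beta>) - 4 * (real l + 1) powr (3 - 2 * \<beta>)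
           + 6 * real l powr (3 - 2 * \<beta>)
           - 4 * (real l - 1) powr (3 - 2 * \<beta>) + (real l - 2) powr (3 - 2 * \<beta>))"

definition stiffness_matrix :: "real \<Rightarrow> real \<Rightarrow> nat \<Rightarrow> real mat" where
  "stiffness_matrix \<beta> h M = mat (M - 1) (M - 1) (\<lambda>(i, j).
     stiffness_entry \<beta> h (if i \<le> j then j - i else i - j))"

definition coefficient_matrix :: "real \<Rightarrow> real \<Rightarrow> real \<Rightarrow> real \<Rightarrow> nat \<Rightarrow> real mat" where
  "coefficient_matrix \<alpha> \<beta> \<tau> h M =
     mass_matrix h M + (Gamma (3 - \<alpha>) / 2 * \<tau> powr \<alpha>) \<cdot>\<^sub>m stiffness_matrix \<beta> h M"

(* Meaningful for symmetric positive definite matrices of positive dimension. *)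

definition cond_number :: "real mat \<Rightarrow> real" where
  "cond_number A = Max (spectrum A) / Min (spectrum A)"

(* On the meaning of  kappa = 1 + O(x)  with  x = tau^alpha h^(-2 beta).
   A bound  |kappa - 1| <= K x  with one K for all tau and h is impossible: for fixed h and
   tau -> 0 we have x -> 0, while kappa tends to the condition number of the mass matrix, which
   is 5/3 for M = 3 and tends to 3 as M grows.  The relation is therefore read as the
   conjunction of
     (i)  kappa = 1 + O(x) on every regime x >= c > 0, with the implied constant uniform in
          tau and h (in particular for h -> 0 with tau fixed), and
     (ii) the bound 1 <= kappa <= K (1 + x), with K uniform over all tau and h without
          restriction: the leading 1 stands for a term of order one. *)

end

theory Submission
  imports Defs
begin

text \<open>With \<open>s = 3 - 2 * \<beta>\<close>, the bracket in the stiffness entry at distance \<open>l\<close> is the fourth central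
  difference of \<open>\<bar>x\<bar> powr s\<close> at \<open>l\<close>. For \<open>1 < s < 2\<close> it is nonnegative for \<open>l \<ge> 1\<close>, and its
  symmetric sums over \<open>\<bar>l\<bar> \<le> n\<close> telescope to third differences of \<open>x powr s\<close>, which are negative.
  Since \<open>cos (\<beta> * pi) < 0\<close>, the stiffness matrix therefore has a positive diagonal and is
  diagonally dominant. Gershgorin's theorem puts the spectrum of the coefficient matrix between
  \<open>h / 3\<close> and \<open>h + 2 * \<theta> * a\<^sub>0\<close>, where \<open>\<theta>\<close> is the factor of the stiffness matrix and \<open>a\<^sub>0\<close> its
  diagonal entry, of order \<open>h powr (1 - 2 * \<beta>)\<close>.\<close>

section \<open>Spectra of real symmetric matrices\<close>

lemma eigenvalue_sum_eq:
  fixes A :: "'a :: field mat"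
  assumes A: "A \<in> carrier_mat n n" and "eigenvalue A k"
  obtains v where "v \<in> carrier_vec n" "v \<noteq> 0\<^sub>v n"
    "\<And>i. i < n \<Longrightarrow> (\<Sum>j<n. A $$ (i, j) * v $ j) = k * v $ i"
proof -
  obtain v where v: "v \<in> carrier_vec n" "v \<noteq> 0\<^sub>v n" "A *\<^sub>v v = k \<cdot>\<^sub>v v"
    using assms unfolding eigenvalue_def eigenvector_def by auto
  have "(\<Sum>j<n. A $$ (i, j) * v $ j) = k * v $ i" if "i < n" for i
  proof -
    have "(A *\<^sub>v v) $ i = (k \<cdot>\<^sub>v v) $ i"
      using v by simp
    then show ?thesis
      using that A v(1) by (simp add: scalar_prod_def lessThan_atLeast0)
  qed
  with v that show thesis by blast
qed

lemma vec_nonzero_entry: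
  fixes v :: "'a :: zero Matrix.vec"
  assumes "v \<in> carrier_vec n" "v \<noteq> 0\<^sub>v n"
  obtains i where "i < n" "v $ i \<noteq> 0"
  using assms by (metis carrier_vecD eq_vecI index_zero_vec)

text \<open>A complex eigenvalue \<open>k\<close> with eigenvector \<open>v\<close> always exists.
  The Hermitian form of \<open>v\<close> equals \<open>k\<close> times the squared norm of
  \<open>v\<close> and is its own conjugate by symmetry, so \<open>k\<close> is real and a root of
  the real characteristic polynomial. This gives meaning to \<open>Max\<close> and
  \<open>Min\<close> in \<open>cond_number\<close>.\<close>

lemma real_symmetric_spectrum_nonempty:
  fixes A :: "real mat"
  assumes A: "A \<in> carrier_mat n n" and n: "0 < n"
    and sym: "\<And>i j. i < n \<Longrightarrow> j < n \<Longrightarrow> A $$ (i, j) = A $$ (j, i)"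
  shows "spectrum A \<noteq> {}"
proof -
  let ?B = "map_mat complex_of_real A"
  have B: "?B \<in> carrier_mat n n" using A by simp
  obtain k where k: "eigenvalue ?B k"
    using spectrum_non_empty[OF B n] unfolding spectrum_def by auto
  obtain v where v: "v \<in> carrier_vec n" "v \<noteq> 0\<^sub>v n"
    and eq: "\<And>i. i < n \<Longrightarrow> (\<Sum>j<n. ?B $$ (i, j) * v $ j) = k * v $ i"
    using eigenvalue_sum_eq[OF B k] by metis
  define S where "S = (\<Sum>i<n. \<Sum>j<n. cnj (v $ i) * complex_of_real (A $$ (i, j)) * v $ j)"
  define N where "N = (\<Sum>i<n. (cmod (v $ i))\<^sup>2)"
  have "S = (\<Sum>i<n. cnj (v $ i) * (\<Sum>j<n. ?B $$ (i, j) * v $ j))"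
    unfolding S_def using A by (simp add: sum_distrib_left mult.assoc)
  also have "\<dots> = (\<Sum>i<n. k * complex_of_real ((cmod (v $ i))\<^sup>2))"
    by (intro sum.cong refl, subst eq)
      (simp_all add: complex_norm_square mult_ac del: of_real_power)
  finally have SN: "S = k * complex_of_real N"
    by (simp add: N_def sum_distrib_left)
  have "cnj S = (\<Sum>i<n. \<Sum>j<n. cnj (v $ j) * complex_of_real (A $$ (i, j)) * v $ i)"
    by (simp add: S_def mult_ac)
  also have "\<dots> = (\<Sum>j<n. \<Sum>i<n. cnj (v $ j) * complex_of_real (A $$ (i, j)) * v $ i)"
    by (rule sum.swap)
  also have "\<dots> = S"
    unfolding S_def by (intro sum.cong refl) (simp add: sym)
  finally have "cnj S = S" .
  obtain i where i: "i < n" "v $ i \<noteq> 0" using vec_nonzero_entry[OF v] .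
  have "0 < (cmod (v $ i))\<^sup>2" using i by simp
  also have "\<dots> \<le> N" unfolding N_def by (rule member_le_sum) (use i in auto)
  finally have "0 < N" .
  with SN \<open>cnj S = S\<close> have "cnj k = k" by auto
  then obtain r where r: "k = complex_of_real r"
    by (metis Reals_cases Reals_cnj_iff)
  have "poly (char_poly ?B) k = 0"
    using k eigenvalue_root_char_poly[OF B] by simp
  then have "poly (char_poly A) r = 0"
    by (simp add: r of_real_hom.char_poly_hom[OF A])
  then show ?thesis
    using spectrum_root_char_poly[OF A] by auto
qed

text \<open>The row to take is one where the eigenvector entry has the largest modulus
  \<open>m\<close>: there every other entry is at most \<open>m\<close>, and \<open>m\<close>
  cancels.\<close>

lemma eigenvalue_gershgorin:
  fixes A :: "real mat"
  assumes A: "A \<in> carrier_mat n n" and k: "eigenvalue A k"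
  obtains i where "i < n" "\<bar>k - A $$ (i, i)\<bar> \<le> (\<Sum>j\<in>{..<n} - {i}. \<bar>A $$ (i, j)\<bar>)"
proof -
  obtain v where v: "v \<in> carrier_vec n" "v \<noteq> 0\<^sub>v n"
    and eq: "\<And>i. i < n \<Longrightarrow> (\<Sum>j<n. A $$ (i, j) * v $ j) = k * v $ i"
    using eigenvalue_sum_eq[OF A k] by metis
  obtain i0 where i0: "i0 < n" "v $ i0 \<noteq> 0" using vec_nonzero_entry[OF v] .
  define m where "m = Max ((\<lambda>i. \<bar>v $ i\<bar>) ` {..<n})"
  have "m \<in> (\<lambda>i. \<bar>v $ i\<bar>) ` {..<n}"
    unfolding m_def by (rule Max_in) (use i0 in auto)
  then obtain i where i: "i < n" "\<bar>v $ i\<bar> = m" by auto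
  have le: "\<bar>v $ j\<bar> \<le> m" if "j < n" for j
    unfolding m_def by (rule Max_ge) (use that in auto)
  have "0 < m" using le[OF i0(1)] i0 by linarith
  have "(k - A $$ (i, i)) * v $ i = (\<Sum>j\<in>{..<n} - {i}. A $$ (i, j) * v $ j)"
    using eq[OF i(1)] sum.remove[of "{..<n}" i "\<lambda>j. A $$ (i, j) * v $ j"] i(1)
    by (simp add: algebra_simps)
  then have "\<bar>k - A $$ (i, i)\<bar> * m = \<bar>\<Sum>j\<in>{..<n} - {i}. A $$ (i, j) * v $ j\<bar>"
    by (metis abs_mult i(2))
  also have "\<dots> \<le> (\<Sum>j\<in>{..<n} - {i}. \<bar>A $$ (i, j) * v $ j\<bar>)"
    by (rule sum_abs)
  also have "\<dots> \<le> (\<Sum>j\<in>{..<n} - {i}. \<bar>A $$ (i, j)\<bar> * m)"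
    by (intro sum_mono) (auto simp: abs_mult intro!: mult_left_mono le)
  also have "\<dots> = (\<Sum>j\<in>{..<n} - {i}. \<bar>A $$ (i, j)\<bar>) * m"
    by (simp add: sum_distrib_right)
  finally show thesis
    using \<open>0 < m\<close> i(1) that by simp
qed

definition sym_toeplitz :: "nat \<Rightarrow> (nat \<Rightarrow> real) \<Rightarrow> real mat" where
  "sym_toeplitz n c = mat n n (\<lambda>(i, j). c (if i \<le> j then j - i else i - j))"

lemma sym_toeplitz_spectrum_nonempty:
  assumes "0 < n"
  shows "spectrum (sym_toeplitz n c) \<noteq> {}"
  by (rule real_symmetric_spectrum_nonempty[of _ n])
    (use assms in \<open>auto simp: sym_toeplitz_def\<close>)

text \<open>In any row the distances to the left and to the right of the diagonal each run through
  an initial part of \<open>{1..<n}\<close>. Counting the full range twice gives one radius for all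
  rows.\<close>

lemma sym_toeplitz_eigenvalue_bound:
  assumes "eigenvalue (sym_toeplitz n c) k"
  shows "\<bar>k - c 0\<bar> \<le> 2 * (\<Sum>l\<in>{1..<n}. \<bar>c l\<bar>)"
proof -
  let ?d = "\<lambda>i j :: nat. if i \<le> j then j - i else i - j"
  have A: "sym_toeplitz n c \<in> carrier_mat n n" by (simp add: sym_toeplitz_def)
  obtain i where i: "i < n" and
    le: "\<bar>k - sym_toeplitz n c $$ (i, i)\<bar> \<le> (\<Sum>j\<in>{..<n} - {i}. \<bar>sym_toeplitz n c $$ (i, j)\<bar>)"
    using eigenvalue_gershgorin[OF A assms] .
  have "(\<Sum>j\<in>{..<n} - {i}. \<bar>sym_toeplitz n c $$ (i, j)\<bar>) =
      (\<Sum>j\<in>{..<i} \<union> {i<..<n}. \<bar>c (?d i j)\<bar>)"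
    using i by (intro sum.cong) (auto simp: sym_toeplitz_def)
  also have "(\<Sum>j\<in>{..<i} \<union> {i<..<n}. \<bar>c (?d i j)\<bar>) =
      (\<Sum>j\<in>{..<i}. \<bar>c (?d i j)\<bar>) + (\<Sum>j\<in>{i<..<n}. \<bar>c (?d i j)\<bar>)"
    by (rule sum.union_disjoint) auto
  also have "(\<Sum>j\<in>{..<i}. \<bar>c (?d i j)\<bar>) = (\<Sum>l\<in>{1..i}. \<bar>c l\<bar>)"
    by (rule sum.reindex_bij_witness[of _ "\<lambda>l. i - l" "\<lambda>j. i - j"]) auto
  also have "(\<Sum>j\<in>{i<..<n}. \<bar>c (?d i j)\<bar>) = (\<Sum>l\<in>{1..<n - i}. \<bar>c l\<bar>)"
    by (rule sum.reindex_bij_witness[of _ "\<lambda>l. l + i" "\<lambda>j. j - i"]) auto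
  also have "(\<Sum>l\<in>{1..i}. \<bar>c l\<bar>) + (\<Sum>l\<in>{1..<n - i}. \<bar>c l\<bar>) \<le>
      (\<Sum>l\<in>{1..<n}. \<bar>c l\<bar>) + (\<Sum>l\<in>{1..<n}. \<bar>c l\<bar>)"
    using i by (intro add_mono sum_mono2) auto
  finally have "(\<Sum>j\<in>{..<n} - {i}. \<bar>sym_toeplitz n c $$ (i, j)\<bar>) \<le> 2 * (\<Sum>l\<in>{1..<n}. \<bar>c l\<bar>)"
    by linarith
  moreover have "sym_toeplitz n c $$ (i, i) = c 0"
    using i by (simp add: sym_toeplitz_def)
  ultimately show ?thesis using le by linarith
qed

lemma cond_number_bounds:
  assumes A: "A \<in> carrier_mat n n" and ne: "spectrum A \<noteq> {}" and "0 < lo"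
    and bounds: "\<And>k. eigenvalue A k \<Longrightarrow> lo \<le> k \<and> k \<le> hi"
  shows "1 \<le> cond_number A" "cond_number A \<le> hi / lo"
proof -
  have fin: "finite (spectrum A)" using card_finite_spectrum[OF A] by simp
  have "Min (spectrum A) \<in> spectrum A" "Max (spectrum A) \<in> spectrum A"
    using fin ne by auto
  then have Mn: "lo \<le> Min (spectrum A)" and Mx: "Max (spectrum A) \<le> hi"
    using bounds unfolding spectrum_def by auto
  have "Min (spectrum A) \<le> Max (spectrum A)" using fin ne by (simp add: Min_le_iff)
  with Mn \<open>0 < lo\<close> Mx show "1 \<le> cond_number A" "cond_number A \<le> hi / lo"
    unfolding cond_number_def by (auto intro!: frac_le)
qed

section \<open>Iterated differences of power functions\<close>

definition fdiff :: "(real \<Rightarrow> real) \<Rightarrow> real \<Rightarrow> real" where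
  "fdiff f x = f (x + 1) - f x"

lemma DERIV_fdiff_pow:
  assumes "\<And>x. 0 < x \<Longrightarrow> (f has_real_derivative f' x) (at x)" and "0 < x"
  shows "((fdiff ^^ k) f has_real_derivative (fdiff ^^ k) f' x) (at x)"
  using \<open>0 < x\<close>
proof (induction k arbitrary: x)
  case (Suc k)
  have "((fdiff ^^ k) f has_real_derivative (fdiff ^^ k) f' (x + 1)) (at (x + 1))"
    using Suc by simp
  then have "((\<lambda>x. (fdiff ^^ k) f (x + 1)) has_real_derivative (fdiff ^^ k) f' (x + 1)) (at x)"
    by (simp add: DERIV_shift)
  from DERIV_diff[OF this Suc.IH[OF Suc.prems]] show ?case
    by (simp add: fdiff_def[abs_def])
qed (use assms in auto)

lemma continuous_on_fdiff_pow:
  assumes "continuous_on {0..} f"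
  shows "continuous_on {0..} ((fdiff ^^ k) f)"
proof (induction k)
  case (Suc k)
  have "continuous_on {0..} (\<lambda>x. (fdiff ^^ k) f (x + 1))"
    by (rule continuous_on_compose2[OF Suc]) (auto intro!: continuous_intros)
  with Suc show ?case
    by (simp add: fdiff_def[abs_def] continuous_on_diff)
qed (use assms in auto)

lemma fdiff_pow_cmult: "(fdiff ^^ k) (\<lambda>x. r * f x) y = r * (fdiff ^^ k) f y"
  by (induction k arbitrary: y) (simp_all add: fdiff_def algebra_simps)

text \<open>The mean value theorem on the interval from \<open>x\<close> to \<open>x + 1\<close>
  trades one difference for one derivative.\<close>

lemma fdiff_pow_powr_step:
  assumes x: "0 \<le> x" and "0 < x \<or> 0 < r"
  obtains y where "x < y" "(fdiff ^^ Suc k) (\<lambda>x. x powr r) x = r * (fdiff ^^ k) (\<lambda>x. x powr (r - 1)) y"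
proof -
  let ?F = "(fdiff ^^ k) (\<lambda>x. x powr r)"
  let ?G = "\<lambda>y. r * (fdiff ^^ k) (\<lambda>x. x powr (r - 1)) y"
  have D: "(?F has_real_derivative ?G y) (at y)" if "0 < y" for y
    unfolding fdiff_pow_cmult[symmetric]
    by (rule DERIV_fdiff_pow) (use that in \<open>auto intro!: derivative_eq_intros\<close>)
  \<comment> \<open>The derivative \<open>D\<close> is available only at positive points. At
    \<open>x = 0\<close> continuity comes from \<open>0 < r\<close> instead.\<close>
  have cont: "continuous_on {x..x + 1} ?F"
  proof (cases "0 < x")
    case True
    show ?thesis
      by (rule DERIV_atLeastAtMost_imp_continuous_on, rule exI, rule D) (use True in simp)
  next
    case False
    have "continuous_on {0..} ?F"
      by (rule continuous_on_fdiff_pow, rule continuous_on_powr')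
        (use False assms in \<open>auto intro!: continuous_intros\<close>)
    then show ?thesis by (rule continuous_on_subset) (use x in auto)
  qed
  have "\<exists>l z. x < z \<and> z < x + 1 \<and> (?F has_real_derivative l) (at z) \<and> ?F (x + 1) - ?F x = (x + 1 - x) * l"
    by (rule MVT[OF _ cont]) (use x D in \<open>auto simp: real_differentiable_def dest: order_le_less_trans\<close>)
  then obtain l z where z: "x < z" and l: "(?F has_real_derivative l) (at z)"
    and eq: "?F (x + 1) - ?F x = l"
    by auto
  have "l = ?G z" using DERIV_unique[OF l D] x z by simp
  with z eq show thesis by (intro that) (auto simp: fdiff_def)
qed

text \<open>The sign of an iterated difference is thus that of the falling factorial. The side
  condition on \<open>r\<close> is needed only once: after one step the intermediate point is
  positive and the exponent may drop below zero.\<close>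

lemma fdiff_pow_powr:
  assumes "0 \<le> x" and "0 < x \<or> 0 < r"
  shows "\<exists>y\<ge>x. (fdiff ^^ k) (\<lambda>x. x powr r) x = (\<Prod>i<k. r - real i) * y powr (r - real k)"
  using assms
proof (induction k arbitrary: x r)
  case (Suc k)
  obtain y where y: "x < y"
    "(fdiff ^^ Suc k) (\<lambda>x. x powr r) x = r * (fdiff ^^ k) (\<lambda>x. x powr (r - 1)) y"
    using fdiff_pow_powr_step[OF Suc.prems] .
  obtain z where z: "y \<le> z"
    "(fdiff ^^ k) (\<lambda>x. x powr (r - 1)) y = (\<Prod>i<k. r - 1 - real i) * z powr (r - 1 - real k)"
    using Suc.IH[of y "r - 1"] y(1) Suc.prems(1) by auto
  have "(\<Prod>i<Suc k. r - real i) = r * (\<Prod>i<k. r - 1 - real i)"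
    by (subst prod.lessThan_Suc_shift) (simp add: algebra_simps)
  with y z show ?case
    by (intro exI[of _ z]) (simp add: algebra_simps)
qed auto

section \<open>Entries of the stiffness matrix\<close>

text \<open>All powers are put in the single exponent \<open>s\<close>. The values at
  \<open>0\<close> and \<open>1\<close> are separate because the difference stencil there reaches
  negative points, where |x| replaces x.\<close>

definition stiffness_bracket :: "real \<Rightarrow> nat \<Rightarrow> real" where
  "stiffness_bracket s l =
     (if l = 0 then 2 * 2 powr s - 8
      else if l = 1 then 3 powr s - 4 * 2 powr s + 7
      else (real l + 2) powr s - 4 * (real l + 1) powr s + 6 * real l powr s
           - 4 * (real l - 1) powr s + (real l - 2) powr s)"

lemma stiffness_entry_eq:
  "stiffness_entry \<beta> h l =
     h powr (1 - 2 * \<beta>) / (2 * cos (\<beta> * pi) * Gamma (4 - 2 * \<beta>)) * stiffness_bracket (3 - 2 * \<beta>) l"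
proof -
  have "2 powr (4 - 2 * \<beta>) = 2 * 2 powr (3 - 2 * \<beta>)"
    using powr_add[of 2 1 "3 - 2 * \<beta>"] by simp
  moreover have "2 powr (5 - 2 * \<beta>) = 4 * 2 powr (3 - 2 * \<beta>)"
    using powr_add[of 2 2 "3 - 2 * \<beta>"] by simp
  ultimately show ?thesis
    by (simp add: stiffness_entry_def stiffness_bracket_def)
qed

context
  fixes s :: real
  assumes s: "1 < s" "s < 2"
begin

abbreviation third_diff :: "nat \<Rightarrow> real" where
  "third_diff m \<equiv> (fdiff ^^ 3) (\<lambda>x. x powr s) (real m)"

lemma third_diff_nonpos: "third_diff m \<le> 0"
proof -
  obtain y where "third_diff m = (\<Prod>i<3. s - real i) * y powr (s - real 3)"
    using fdiff_pow_powr[of "real m" s 3] s by auto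
  moreover have "(\<Prod>i<3. s - real i) = s * (s - 1) * (s - 2)"
    by (simp add: numeral_eq_Suc)
  moreover have "s * (s - 1) * (s - 2) \<le> 0"
    using s by (intro mult_nonneg_nonpos mult_nonneg_nonneg) auto
  ultimately show ?thesis by (simp add: mult_nonpos_nonneg)
qed

lemma stiffness_bracket_eq_diff:
  "stiffness_bracket s (m + 2) = third_diff (Suc m) - third_diff m"
  by (simp add: stiffness_bracket_def fdiff_def numeral_eq_Suc algebra_simps)

text \<open>The central difference at \<open>m + 2\<close> is the forward difference at
  \<open>m\<close>, with the sign of \<open>s * (s - 1) * (s - 2) * (s - 3)\<close>. For distance
  \<open>1\<close> the stencil crosses the origin, so that case needs its own argument.\<close>

lemma stiffness_bracket_nonneg_ge_2: "0 \<le> stiffness_bracket s (m + 2)"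
proof -
  obtain y where "(fdiff ^^ 4) (\<lambda>x. x powr s) (real m) = (\<Prod>i<4. s - real i) * y powr (s - real 4)"
    using fdiff_pow_powr[of "real m" s 4] s by auto
  moreover have "(\<Prod>i<4. s - real i) = s * (s - 1) * ((s - 2) * (s - 3))"
    by (simp add: numeral_eq_Suc)
  moreover have "0 \<le> s * (s - 1) * ((s - 2) * (s - 3))"
    using s by (intro mult_nonneg_nonneg mult_nonpos_nonpos) auto
  moreover have "stiffness_bracket s (m + 2) = (fdiff ^^ 4) (\<lambda>x. x powr s) (real m)"
    by (simp add: stiffness_bracket_def fdiff_def numeral_eq_Suc algebra_simps)
  ultimately show ?thesis by simp
qed

text \<open>Dividing by \<open>2 powr s\<close> leaves a convex function of \<open>s\<close> that vanishes at \<open>2\<close>; the bound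
  \<open>exp y \<ge> 1 + y\<close> is its tangent there.\<close>

lemma stiffness_bracket_1_nonneg: "0 \<le> stiffness_bracket s 1"
proof -
  define t where "t = 2 - s"
  have t: "0 < t" using s by (simp add: t_def)
  have s_eq: "s = 2 - t" by (simp add: t_def)
  have e3: "3 powr s = 2 powr s * (9 / 4 * (2 / 3) powr t)"
    unfolding s_eq by (simp add: powr_diff powr_divide)
  have e1: "1 = 2 powr s * (1 / 4 * 2 powr t)"
    unfolding s_eq by (simp add: powr_diff)
  have "(2 / 3) powr t \<ge> 1 + t * ln (2 / 3)" "(2::real) powr t \<ge> 1 + t * ln 2"
    by (simp_all add: powr_def exp_ge_add_one_self)
  then have "9 * (2 / 3) powr t + 7 * 2 powr t - 16 \<ge> t * (9 * ln (2 / 3) + 7 * ln (2::real))"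
    by (simp add: algebra_simps)
  moreover have "9 * ln (2 / 3) + 7 * ln (2::real) = ln ((2 / 3) ^ 9 * 2 ^ 7)"
    using ln_mult_pos[of "(2 / 3) ^ 9" "2 ^ 7"] ln_realpow[of "2 / 3" 9] ln_realpow[of 2 7]
    by (metis of_nat_numeral zero_less_divide_iff zero_less_numeral zero_less_power)
  \<comment> \<open>The argument is 65536 / 19683, which exceeds 1.\<close>
  moreover have "0 \<le> ln ((2 / 3) ^ 9 * 2 ^ 7 :: real)"
    by (rule ln_ge_zero) (simp add: field_simps)
  ultimately have "0 \<le> 9 * (2 / 3) powr t + 7 * 2 powr t - 16"
    using t by (smt (verit) mult_nonneg_nonneg)
  then have "0 \<le> 2 powr s * ((9 * (2 / 3) powr t + 7 * 2 powr t - 16) / 4)"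
    by simp
  also have "\<dots> = 3 powr s - 4 * 2 powr s + 7 * 1"
    by (subst e3, subst e1) (simp add: algebra_simps diff_divide_distrib add_divide_distrib)
  finally show ?thesis by (simp add: stiffness_bracket_def)
qed

lemma stiffness_bracket_nonneg:
  assumes "1 \<le> l"
  shows "0 \<le> stiffness_bracket s l"
proof (cases "l = 1")
  case False
  with assms obtain m where "l = m + 2"
    by (metis One_nat_def Suc_1 add.commute le_Suc_ex le_antisym not_less_eq_eq)
  then show ?thesis using stiffness_bracket_nonneg_ge_2 by simp
qed (use stiffness_bracket_1_nonneg in simp)

text \<open>The left side is the sum of the fourth central differences over all integers of modulus
  at most \<open>m + 1\<close>. It telescopes to two boundary third differences, which agree up to
  sign because |x| is even; hence the factor 2.\<close>

lemma stiffness_bracket_sum: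
  "stiffness_bracket s 0 + 2 * (\<Sum>l\<in>{1..<m + 2}. stiffness_bracket s l) = 2 * third_diff m"
proof (induction m)
  case 0
  show ?case
    by (simp add: stiffness_bracket_def fdiff_def numeral_eq_Suc algebra_simps)
next
  case (Suc m)
  then show ?case
    using stiffness_bracket_eq_diff[of m] by simp
qed

lemma stiffness_bracket_dominated:
  "2 * (\<Sum>l\<in>{1..<n}. stiffness_bracket s l) \<le> - stiffness_bracket s 0"
proof -
  \<comment> \<open>Adding two nonnegative terms brings the range into the form of the telescoped
    sum.\<close>
  have "(\<Sum>l\<in>{1..<n}. stiffness_bracket s l) \<le> (\<Sum>l\<in>{1..<n + 2}. stiffness_bracket s l)"
    by (rule sum_mono2) (auto intro: stiffness_bracket_nonneg)
  with stiffness_bracket_sum[of n] third_diff_nonpos[of n] show ?thesis by linarith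
qed

end

section \<open>The spectrum of the coefficient matrix\<close>

lemma coefficient_matrix_toeplitz:
  "coefficient_matrix \<alpha> \<beta> \<tau> h M = sym_toeplitz (M - 1) (\<lambda>l.
     (if l = 0 then 4 * h / 6 else if l = 1 then h / 6 else 0) +
     Gamma (3 - \<alpha>) / 2 * \<tau> powr \<alpha> * stiffness_entry \<beta> h l)"
  by (rule eq_matI)
    (auto simp: coefficient_matrix_def mass_matrix_def stiffness_matrix_def sym_toeplitz_def)

lemma coefficient_matrix_eigenvalue_bounds:
  assumes \<alpha>: "0 < \<alpha>" "\<alpha> < 1" and \<beta>: "1 / 2 < \<beta>" "\<beta> < 1" and "0 < h"
    and ev: "eigenvalue (coefficient_matrix \<alpha> \<beta> \<tau> h M) k"
  shows "h / 3 \<le> k"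
    and "k \<le> h + Gamma (3 - \<alpha>) * \<tau> powr \<alpha> * stiffness_entry \<beta> h 0"
proof -
  define s where "s = 3 - 2 * \<beta>"
  define \<theta> where "\<theta> = Gamma (3 - \<alpha>) / 2 * \<tau> powr \<alpha>"
  define d where "d = - (h powr (1 - 2 * \<beta>) / (2 * cos (\<beta> * pi) * Gamma (4 - 2 * \<beta>)))"
  define m where "m l = (if l = 0 then 4 * h / 6 else if l = 1 then h / 6 else 0)" for l :: nat
  have s: "1 < s" "s < 2" using \<beta> by (auto simp: s_def)
  \<comment> \<open>This is the negative of \<open>cos (\<beta> * pi)\<close>, with its angle moved
    into the first quadrant.\<close>
  have "0 < cos ((1 - \<beta>) * pi)"
  proof (rule cos_gt_zero_pi)
    have "(1 - \<beta>) * pi < 1 / 2 * pi" using \<beta> by (intro mult_strict_right_mono) auto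
    then show "(1 - \<beta>) * pi < pi / 2" by simp
    have "0 < (1 - \<beta>) * pi" using \<beta> by simp
    then show "- (pi / 2) < (1 - \<beta>) * pi" using pi_gt_zero by linarith
  qed
  then have "cos (\<beta> * pi) < 0" by (simp add: left_diff_distrib cos_diff)
  moreover have "0 < Gamma (4 - 2 * \<beta>)" using \<beta> by (intro Gamma_real_pos) simp
  ultimately have d: "0 \<le> d"
    unfolding d_def by (simp add: divide_nonneg_nonpos mult_nonpos_nonneg divide_nonneg_neg
        mult_neg_pos less_imp_le)
  have \<theta>: "0 \<le> \<theta>" using \<alpha> by (simp add: \<theta>_def)
  have entry: "stiffness_entry \<beta> h l = - d * stiffness_bracket s l" for l
    by (simp add: stiffness_entry_eq d_def s_def)
  define e where "e = - (\<theta> * d * stiffness_bracket s 0)"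
  have e: "\<theta> * stiffness_entry \<beta> h 0 = e" by (simp add: e_def entry)
  \<comment> \<open>Off the diagonal the stiffness entries are nonpositive, so the triangle
    inequality flips their sign.\<close>
  have "\<bar>m l + \<theta> * stiffness_entry \<beta> h l\<bar> \<le> m l + \<theta> * d * stiffness_bracket s l" if "1 \<le> l" for l
  proof -
    have "0 \<le> \<theta> * d * stiffness_bracket s l"
      using \<theta> d stiffness_bracket_nonneg[OF s that] by simp
    moreover have "0 \<le> m l" using \<open>0 < h\<close> by (simp add: m_def)
    ultimately show ?thesis by (simp add: entry abs_le_iff mult.assoc)
  qed
  then have "(\<Sum>l\<in>{1..<M - 1}. \<bar>m l + \<theta> * stiffness_entry \<beta> h l\<bar>)
      \<le> (\<Sum>l\<in>{1..<M - 1}. m l + \<theta> * d * stiffness_bracket s l)"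
    by (intro sum_mono) auto
  also have "\<dots> = (\<Sum>l\<in>{1..<M - 1}. m l) + \<theta> * d * (\<Sum>l\<in>{1..<M - 1}. stiffness_bracket s l)"
    by (simp add: sum.distrib sum_distrib_left)
  finally have 1: "(\<Sum>l\<in>{1..<M - 1}. \<bar>m l + \<theta> * stiffness_entry \<beta> h l\<bar>)
      \<le> (\<Sum>l\<in>{1..<M - 1}. m l) + \<theta> * d * (\<Sum>l\<in>{1..<M - 1}. stiffness_bracket s l)" .
  \<comment> \<open>Inserting \<open>1\<close> also covers small \<open>M\<close>, for which the
    range is empty.\<close>
  have "(\<Sum>l\<in>{1..<M - 1}. m l) \<le> (\<Sum>l\<in>insert 1 {1..<M - 1}. m l)"
    using \<open>0 < h\<close> by (intro sum_mono2) (auto simp: m_def)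
  also have "\<dots> = (\<Sum>l\<in>{1}. m l)"
    by (rule sum.mono_neutral_right) (auto simp: m_def)
  also have "\<dots> = h / 6" by (simp add: m_def)
  finally have 2: "(\<Sum>l\<in>{1..<M - 1}. m l) \<le> h / 6" .
  have "2 * (\<theta> * d * (\<Sum>l\<in>{1..<M - 1}. stiffness_bracket s l)) \<le> e"
    using mult_left_mono[OF stiffness_bracket_dominated[OF s, of "M - 1"], of "\<theta> * d"] \<theta> d
    by (simp add: e_def algebra_simps)
  with 1 2 have rad: "2 * (\<Sum>l\<in>{1..<M - 1}. \<bar>m l + \<theta> * stiffness_entry \<beta> h l\<bar>) \<le> h / 3 + e"
    by linarith
  have "\<bar>k - (m 0 + \<theta> * stiffness_entry \<beta> h 0)\<bar>
      \<le> 2 * (\<Sum>l\<in>{1..<M - 1}. \<bar>m l + \<theta> * stiffness_entry \<beta> h l\<bar>)"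
    using sym_toeplitz_eigenvalue_bound[OF ev[unfolded coefficient_matrix_toeplitz]]
    by (simp add: m_def \<theta>_def)
  \<comment> \<open>The stiffness part \<open>e\<close> occurs in both centre and radius: it cancels
    at the lower end, leaving \<open>h / 3\<close>, and doubles at the upper end.\<close>
  with rad have *: "\<bar>k - (4 * h / 6 + e)\<bar> \<le> h / 3 + e" by (simp add: e m_def)
  then show "h / 3 \<le> k" by linarith
  have "Gamma (3 - \<alpha>) * \<tau> powr \<alpha> * stiffness_entry \<beta> h 0 = 2 * e"
    unfolding e[symmetric] \<theta>_def by simp
  with * show "k \<le> h + Gamma (3 - \<alpha>) * \<tau> powr \<alpha> * stiffness_entry \<beta> h 0" by linarith
qed

text \<open>The factor \<open>h\<close> split off here cancels against the lower spectral bound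
  \<open>h / 3\<close>, which leaves a constant independent of \<open>h\<close>.\<close>

lemma stiffness_entry_scale:
  assumes "0 < h"
  shows "stiffness_entry \<beta> h l = h * h powr (- 2 * \<beta>) * stiffness_entry \<beta> 1 l"
proof -
  have "h powr (1 - 2 * \<beta>) = h * h powr (- 2 * \<beta>)"
    using powr_add[of h 1 "- 2 * \<beta>"] assms by simp
  then show ?thesis by (simp add: stiffness_entry_eq)
qed

lemma coefficient_matrix_cond_number:
  assumes "0 < \<alpha>" "\<alpha> < 1" and "1 / 2 < \<beta>" "\<beta> < 1" and h: "0 < h" and M: "2 \<le> M"
  shows "1 \<le> cond_number (coefficient_matrix \<alpha> \<beta> \<tau> h M)"
    and "cond_number (coefficient_matrix \<alpha> \<beta> \<tau> h M)
      \<le> 3 + 3 * Gamma (3 - \<alpha>) * stiffness_entry \<beta> 1 0 * (\<tau> powr \<alpha> * h powr (- 2 * \<beta>))"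
proof -
  let ?C = "coefficient_matrix \<alpha> \<beta> \<tau> h M"
  let ?hi = "h + Gamma (3 - \<alpha>) * \<tau> powr \<alpha> * stiffness_entry \<beta> h 0"
  have C: "?C \<in> carrier_mat (M - 1) (M - 1)"
    by (simp add: coefficient_matrix_toeplitz sym_toeplitz_def)
  have ne: "spectrum ?C \<noteq> {}"
    unfolding coefficient_matrix_toeplitz using M by (intro sym_toeplitz_spectrum_nonempty) simp
  have b: "h / 3 \<le> k \<and> k \<le> ?hi" if "eigenvalue ?C k" for k
    using coefficient_matrix_eigenvalue_bounds[OF assms(1-4) h that] by blast
  have "0 < h / 3" using h by simp
  note kappa = cond_number_bounds[OF C ne this b]
  show "1 \<le> cond_number ?C" by (rule kappa)
  have "?hi / (h / 3) = 3 + 3 * Gamma (3 - \<alpha>) * stiffness_entry \<beta> 1 0 * (\<tau> powr \<alpha> * h powr (- 2 * \<beta>))"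
    unfolding stiffness_entry_scale[OF h, of \<beta> 0] using h by (simp add: field_simps)
  with kappa(2) show "cond_number ?C
      \<le> 3 + 3 * Gamma (3 - \<alpha>) * stiffness_entry \<beta> 1 0 * (\<tau> powr \<alpha> * h powr (- 2 * \<beta>))"
    by simp
qed

theorem theorem2:
  fixes \<alpha> \<beta> a b T :: real
  assumes "0 < \<alpha>" "\<alpha> < 1"
    and "1 / 2 < \<beta>" "\<beta> < 1"
    and "a < b" and "0 < T"
  shows "(\<forall>c>0. \<exists>K>0. \<forall>N\<ge>1. \<forall>M\<ge>2.
            let \<tau> = T / real N; h = (b - a) / real M;
                \<kappa> = cond_number (coefficient_matrix \<alpha> \<beta> \<tau> h M)
            in \<tau> powr \<alpha> * h powr (- 2 * \<beta>) \<ge> c \<longrightarrow>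
               \<bar>\<kappa> - 1\<bar> \<le> K * (\<tau> powr \<alpha> * h powr (- 2 * \<beta>)))
       \<and> (\<exists>K>0. \<forall>N\<ge>1. \<forall>M\<ge>2.
            let \<tau> = T / real N; h = (b - a) / real M;
                \<kappa> = cond_number (coefficient_matrix \<alpha> \<beta> \<tau> h M)
            in 1 \<le> \<kappa> \<and> \<kappa> \<le> K * (1 + \<tau> powr \<alpha> * h powr (- 2 * \<beta>)))"
proof -
  \<comment> \<open>The absolute value makes \<open>G\<close> nonnegative without a separate sign
    argument.\<close>
  define G where "G = \<bar>3 * Gamma (3 - \<alpha>) * stiffness_entry \<beta> 1 0\<bar>"
  define \<kappa> where "\<kappa> N M = cond_number (coefficient_matrix \<alpha> \<beta> (T / real N) ((b - a) / real M) M)"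
    for N M :: nat
  define x where "x N M = (T / real N) powr \<alpha> * ((b - a) / real M) powr (- 2 * \<beta>)" for N M :: nat
  have G: "0 \<le> G" by (simp add: G_def)
  have x: "0 \<le> x N M" for N M by (simp add: x_def)
  have \<kappa>: "1 \<le> \<kappa> N M" "\<kappa> N M \<le> 3 + G * x N M" if "2 \<le> M" for N M
  proof -
    have h: "0 < (b - a) / real M" using \<open>a < b\<close> that by simp
    note bounds = coefficient_matrix_cond_number[OF assms(1-4) h that, of "T / real N"]
    show "1 \<le> \<kappa> N M" using bounds(1) by (simp add: \<kappa>_def)
    have "3 * Gamma (3 - \<alpha>) * stiffness_entry \<beta> 1 0 * x N M \<le> G * x N M"
      by (rule mult_right_mono) (use x in \<open>auto simp: G_def\<close>)
    with bounds(2) show "\<kappa> N M \<le> 3 + G * x N M" unfolding \<kappa>_def x_def by linarith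
  qed
  \<comment> \<open>The constant 3 from the mass matrix is absorbed into
    \<open>3 / c * x N M\<close>; this is where \<open>x\<close> must stay away from zero.\<close>
  have "\<bar>\<kappa> N M - 1\<bar> \<le> (3 / c + G) * x N M" if "0 < c" "2 \<le> M" "c \<le> x N M" for c N M
  proof -
    have "3 \<le> 3 / c * x N M" using that by (simp add: field_simps)
    with \<kappa>[OF \<open>2 \<le> M\<close>, of N] show ?thesis by (simp add: algebra_simps)
  qed
  then have "\<exists>K>0. \<forall>N\<ge>1. \<forall>M\<ge>2. c \<le> x N M \<longrightarrow> \<bar>\<kappa> N M - 1\<bar> \<le> K * x N M" if "0 < c" for c
    using that G by (intro exI[of _ "3 / c + G"]) (auto intro: add_pos_nonneg)
  moreover have "\<kappa> N M \<le> (3 + G) * (1 + x N M)" if "2 \<le> M" for N M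
    using \<kappa>(2)[OF that, of N] x[of N M] G by (simp add: algebra_simps)
  then have "\<exists>K>0. \<forall>N\<ge>1. \<forall>M\<ge>2. 1 \<le> \<kappa> N M \<and> \<kappa> N M \<le> K * (1 + x N M)"
    using \<kappa>(1) G by (intro exI[of _ "3 + G"]) auto
  ultimately show ?thesis
    unfolding \<kappa>_def x_def Let_def by blast
qed

end
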